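(* Let the primal-dual problem have a unique optimal solution $u^*=(x^*,s^*,y^* )$, and let $x^*+s^*>0$. If a point $z=(u,w)$ in the interior of $\mathcal F$, $u=(x,s,y)$, $w=(v^{(0)},v)$, satisfies the centering condition $\delta(z)\le\beta$ with $\beta\in[0,\frac13)$, and $$\mu^*(w)=\frac{(v^{(0)})^2}{v^{(0)}-\|v\|^2}<(1-\beta)\frac{\pi_*}{n+1},$$ then for each of the three indicator vectors $a=x$, $a=s^{-1}$, $a=xs^{-1}$, the candidate point $u_a^*=(x_a^*,s_a^*,y_a^* )$ is the optimal primal-dual solution of the problem, i.e. $A_{B_a}$ is non-degenerate and $u_a^*=u^*$.
   Context: Let $A\in\mathbb{R}^{m\times n}$, $b\in\mathbb{R}^m$, $c\in\mathbb{R}^n$. The primal-dual pair is $\min\{\langle c,x\rangle: Ax=b,\ x\ge 0\}=\max\{\langle b,y\rangle: s+A^Ty=c,\ s\ge 0\}$. Let $\mathcal F_0=\{u=(x,s,y): Ax=b,\ s+A^Ty=c,\ x>0,\ s>0\}$, assumed nonempty. Here $x^*_{\min}$ is the minimum of the positive components of $x^*$, $s^*_{\min}$ is the minimum of the positive components of $s^*$, and $\pi_*=x^*_{\min}s^*_{\min}$. Arithmetic operations and relations on vectors are componentwise; $\|\cdot\|$ is the Euclidean norm. Control variables: $w=(v^{(0)},v)\in\mathcal F_p=\{(v^{(0)},v)\in\mathbb{R}_+\times\mathbb{R}^n: v^{(0)}>\|v\|^2\}$, $\rho(w)=\frac{v^{(0)}-\|v\|^2}{n+1}$. For $z=(u,w)$,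 the residual $r(z)\in\mathbb{R}^{n+1}$ has components $r^{(0)}(z)=v^{(0)}-\langle s,x\rangle$, $r^{(i)}(z)=x^{(i)}s^{(i)}-(v^{(i)})^2$ for $1\le i\le n$. Let $\mathcal F=\{(u,w): u\in\mathcal F_0, w\in\mathcal F_p, r(z)\ge0\}$; its interior is given by $r(z)>0$. For $k=0,1,2$ let $\chi_k(z)=\Big[\sum_{i=0}^n\frac{(r^{(i)}(z)-\rho(w))^2}{[r^{(i)}(z)]^k[\rho(w)]^{2-k}}\Big]^{1/2}$ and $\delta(z)=\chi_1^2(z)/\chi_2(z)$ ($\delta(z)=0$ if $\chi_2(z)=0$). For an indicator vector $a\in\mathbb{R}^n$, $a>0$, let $\pi_a$ be a permutation of $\{1,\dots,n\}$ ordering the components of $a$ decreasingly: $a^{(\pi_a[i])}\ge a^{(\pi_a[i+1])}$, $i=1,\dots,n-1$. The trial basis is $B_a=\{\pi_a[i]: 1\le i\le m\}$, $N_a=\{1,\dots,n\}\setminus B_a$, and the candidate point $u_a^*=(x_a^*,s_a^*,y_a^* )$ is given by $x^*_{B_a}=A_{B_a}^{-1}b$, $x^*_{N_a}=0$, $y_a^*=A_{B_a}^{-T}c_{B_a}$, $s^*_{B_a}=0$, $s^*_{N_a}=c_{N_a}-A_{N_a}^Ty_a^*$, where $A_{B_a},A_{N_a}$ are the submatrices of the columns of $A$ indexed by $B_a,N_a$. *)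

theory Defs
  imports "HOL-Analysis.Analysis"
begin

section \<open>The primal-dual pair\<close>

text \<open>Points u = (x, s, y). Strict inequalities are spelled out componentwise because
  the library order on vectors has a strict part that is not componentwise.\<close>

type_synonym ('m, 'n) pd_point = "(real ^ 'n) \<times> (real ^ 'n) \<times> (real ^ 'm)"

definition primal_feasible :: "real ^ 'n ^ 'm \<Rightarrow> real ^ 'm \<Rightarrow> real ^ 'n \<Rightarrow> bool" where
  "primal_feasible A b x \<longleftrightarrow> A *v x = b \<and> (\<forall>i. 0 \<le> x $ i)"

definition dual_feasible :: "real ^ 'n ^ 'm \<Rightarrow> real ^ 'n \<Rightarrow> real ^ 'n \<Rightarrow> real ^ 'm \<Rightarrow> bool" where
  "dual_feasible A c s y \<longleftrightarrow> s + transpose A *v y = c \<and> (\<forall>i. 0 \<le> s $ i)"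

definition primal_optimal ::
    "real ^ 'n ^ 'm \<Rightarrow> real ^ 'm \<Rightarrow> real ^ 'n \<Rightarrow> real ^ 'n \<Rightarrow> bool" where
  "primal_optimal A b c x \<longleftrightarrow>
     primal_feasible A b x \<and> (\<forall>x'. primal_feasible A b x' \<longrightarrow> c \<bullet> x \<le> c \<bullet> x')"

definition dual_optimal ::
    "real ^ 'n ^ 'm \<Rightarrow> real ^ 'm \<Rightarrow> real ^ 'n \<Rightarrow> real ^ 'n \<Rightarrow> real ^ 'm \<Rightarrow> bool" where
  "dual_optimal A b c s y \<longleftrightarrow>
     dual_feasible A c s y \<and> (\<forall>s' y'. dual_feasible A c s' y' \<longrightarrow> b \<bullet> y' \<le> b \<bullet> y)"

definition optimal_solution ::
    "real ^ 'n ^ 'm \<Rightarrow> real ^ 'm \<Rightarrow> real ^ 'n \<Rightarrow> ('m, 'n) pd_point \<Rightarrow> bool" where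
  "optimal_solution A b c = (\<lambda>(x, s, y). primal_optimal A b c x \<and> dual_optimal A b c s y)"

definition unique_optimal_solution ::
    "real ^ 'n ^ 'm \<Rightarrow> real ^ 'm \<Rightarrow> real ^ 'n \<Rightarrow> ('m, 'n) pd_point \<Rightarrow> bool" where
  "unique_optimal_solution A b c u \<longleftrightarrow>
     optimal_solution A b c u \<and> (\<forall>u'. optimal_solution A b c u' \<longrightarrow> u' = u)"

definition strictly_feasible ::
    "real ^ 'n ^ 'm \<Rightarrow> real ^ 'm \<Rightarrow> real ^ 'n \<Rightarrow> ('m, 'n) pd_point set" where
  "strictly_feasible A b c =
     {(x, s, y). A *v x = b \<and> s + transpose A *v y = c \<and> (\<forall>i. 0 < x $ i) \<and> (\<forall>i. 0 < s $ i)}"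

text \<open>Minimum of the positive components. It is taken in the extended reals so that a vector
  without positive components (e.g. the optimal slack when m = n) gets the value
  \<open>\<infinity>\<close> (minimum over the empty set) rather than an unspecified real.\<close>

definition pos_min :: "real ^ 'n \<Rightarrow> ereal" where
  "pos_min x = (INF i\<in>{i. 0 < x $ i}. ereal (x $ i))"

section \<open>Control variables and residuals\<close>

type_synonym 'n control = "real \<times> (real ^ 'n)"

definition control_set :: "'n::finite control set" where
  "control_set = {(v0, v). 0 \<le> v0 \<and> (norm v)\<^sup>2 < v0}"

definition rho :: "'n::finite control \<Rightarrow> real" where
  "rho = (\<lambda>(v0, v). (v0 - (norm v)\<^sup>2) / (real CARD('n) + 1))"

definition mu_star :: "'n::finite control \<Rightarrow> real" where
  "mu_star = (\<lambda>(v0, v). v0\<^sup>2 / (v0 - (norm v)\<^sup>2))"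

text \<open>The index range 0..n of the residual is the type \<open>'n option\<close>:
  \<open>None\<close> plays the role of 0.\<close>

definition residual :: "('m, 'n::finite) pd_point \<times> 'n control \<Rightarrow> real ^ 'n option" where
  "residual = (\<lambda>((x, s, y), (v0, v)).
     \<chi> j. case j of None \<Rightarrow> v0 - s \<bullet> x | Some i \<Rightarrow> x $ i * s $ i - (v $ i)\<^sup>2)"

definition target_domain ::
    "real ^ 'n ^ 'm \<Rightarrow> real ^ 'm \<Rightarrow> real ^ 'n \<Rightarrow> (('m, 'n) pd_point \<times> 'n control) set" where
  "target_domain A b c =
     {(u, w). u \<in> strictly_feasible A b c \<and> w \<in> control_set \<and> (\<forall>j. 0 \<le> residual (u, w) $ j)}"

text \<open>The interior is meant relative to the affine subspace cut out by the linear equations.\<close>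

definition target_interior ::
    "real ^ 'n ^ 'm \<Rightarrow> real ^ 'm \<Rightarrow> real ^ 'n \<Rightarrow> (('m, 'n) pd_point \<times> 'n control) set" where
  "target_interior A b c = {z \<in> target_domain A b c. \<forall>j. 0 < residual z $ j}"

text \<open>Used for k = 0, 1, 2 only.\<close>

definition chi :: "nat \<Rightarrow> ('m, 'n::finite) pd_point \<times> 'n control \<Rightarrow> real" where
  "chi k z =
     sqrt (\<Sum>j\<in>UNIV. (residual z $ j - rho (snd z))\<^sup>2
                        / ((residual z $ j) ^ k * rho (snd z) ^ (2 - k)))"

definition delta :: "('m, 'n::finite) pd_point \<times> 'n control \<Rightarrow> real" where
  "delta z = (if chi 2 z = 0 then 0 else (chi 1 z)\<^sup>2 / chi 2 z)"

section \<open>Trial basis and candidate point\<close>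

text \<open>Positions are natural numbers 1..n, while coordinates are elements of \<open>'n\<close>.\<close>

definition decreasing_ordering :: "real ^ 'n \<Rightarrow> (nat \<Rightarrow> 'n) \<Rightarrow> bool" where
  "decreasing_ordering a p \<longleftrightarrow>
     bij_betw p {1..CARD('n)} UNIV \<and> (\<forall>i\<in>{1..<CARD('n)}. a $ p (i + 1) \<le> a $ p i)"

definition trial_basis :: "nat \<Rightarrow> (nat \<Rightarrow> 'n) \<Rightarrow> 'n set" where
  "trial_basis m p = p ` {1..m}"

text \<open>A basis B with m elements is numbered by the row index type \<open>'m\<close>, so that the column
  submatrix \<open>A\<^sub>B\<close> becomes a square matrix. The numbering is an arbitrary bijection; neither
  invertibility of \<open>A\<^sub>B\<close> nor the candidate point depends on its choice.\<close>

definition basis_index :: "'n set \<Rightarrow> 'm::finite \<Rightarrow> 'n" where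
  "basis_index B = (SOME e. bij_betw e UNIV B)"

definition basis_matrix :: "real ^ 'n ^ 'm \<Rightarrow> 'n set \<Rightarrow> real ^ 'm ^ 'm" where
  "basis_matrix A B = (\<chi> i j. A $ i $ basis_index B j)"

definition basis_part :: "real ^ 'n \<Rightarrow> 'n set \<Rightarrow> real ^ 'm" where
  "basis_part c B = (\<chi> j. c $ basis_index B j)"

definition candidate_x :: "real ^ 'n ^ 'm \<Rightarrow> real ^ 'm \<Rightarrow> 'n set \<Rightarrow> real ^ 'n" where
  "candidate_x A b B =
     (\<chi> k. if k \<in> B then (matrix_inv (basis_matrix A B) *v b) $ inv (basis_index B) k else 0)"

definition candidate_y :: "real ^ 'n ^ 'm \<Rightarrow> real ^ 'n \<Rightarrow> 'n set \<Rightarrow> real ^ 'm" where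
  "candidate_y A c B = transpose (matrix_inv (basis_matrix A B)) *v basis_part c B"

definition candidate_s :: "real ^ 'n ^ 'm \<Rightarrow> real ^ 'n \<Rightarrow> 'n set \<Rightarrow> real ^ 'n" where
  "candidate_s A c B =
     (\<chi> k. if k \<in> B then 0 else c $ k - column k A \<bullet> candidate_y A c B)"

definition candidate ::
    "real ^ 'n ^ 'm \<Rightarrow> real ^ 'm \<Rightarrow> real ^ 'n \<Rightarrow> 'n set \<Rightarrow> ('m, 'n) pd_point" where
  "candidate A b c B = (candidate_x A b B, candidate_s A c B, candidate_y A c B)"

end

theory Submission
  imports Defs
begin

text \<open>
  Let \<open>B\<close> be the support of \<open>xs\<close>. The proof shows that \<open>B\<close> is the optimal basis and that each of
  the three indicator vectors is strictly larger on \<open>B\<close> than off \<open>B\<close>; an ordering by decreasing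
  components then lists \<open>B\<close> first, and the candidate point built from \<open>B\<close> is the optimum.

  Uniqueness of the optimum excludes nonzero perturbations that keep a point optimal. On the primal
  side this says that the columns of \<open>A\<close> indexed by \<open>B\<close> are linearly independent
  (\<open>unique_optimal_primal_kernel_trivial\<close>), on the dual side that they span
  (\<open>unique_optimal_dual_kernel_trivial\<close>). Hence \<open>B\<close> has exactly as many elements as \<open>A\<close> has rows
  and the basis matrix is invertible. Both statements rely on strict complementarity, that is, on
  \<open>ss\<close> vanishing exactly on \<open>B\<close>. Since \<open>xs\<close> and \<open>ss\<close> are only given as separate optima of the two
  problems, this requires strong duality. The latter follows by separating \<open>(b, c \<bullet> xs)\<close> from the
  convex set of the points \<open>(A *v x, r)\<close> with \<open>x \<ge> 0\<close> and \<open>r > c \<bullet> x\<close>; the hyperplane is not vertical,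
  because a strictly feasible point exists and \<open>A\<close> has full row rank
  (\<open>exists_dual_with_primal_value\<close>).

  For the separation of the indicators, write \<open>\<rho>\<close> for \<open>rho w\<close>. The centering condition gives
  \<open>x\<^sub>k s\<^sub>k \<ge> (1 - \<beta>) \<rho>\<close> for all \<open>k\<close> (\<open>residual_ge_of_delta_le\<close>), and orthogonality of the primal and
  dual feasible directions gives \<open>xs\<^sub>i s\<^sub>i < v0\<close> and \<open>x\<^sub>j ss\<^sub>j < v0\<close>. So for \<open>i\<close> in \<open>B\<close> and \<open>j\<close> outside,
  \<open>x\<^sub>i \<ge> (1 - \<beta>) \<rho> xs\<^sub>i / v0\<close> and \<open>x\<^sub>j < v0 / ss\<^sub>j\<close>,
  and the assumption on \<open>mu_star\<close>, which gives \<open>v0\<^sup>2 < (1 - \<beta>) \<rho> xs\<^sub>i ss\<^sub>j\<close> after multiplication by \<open>\<rho>\<close>,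
  yields \<open>x\<^sub>j < x\<^sub>i\<close>. The same argument with the two sides exchanged yields \<open>s\<^sub>i < s\<^sub>j\<close>.
\<close>

section \<open>Feasible perturbations\<close>

lemma inner_transpose:
  fixes A :: "real ^ 'n ^ 'm"
  shows "(transpose A *v y) \<bullet> x = y \<bullet> (A *v x)"
  by (simp add: dot_lmul_matrix)

lemma exists_step_preserving_nonneg:
  fixes f g :: "real ^ 'n"
  assumes f: "\<And>i. 0 \<le> f $ i" and g: "\<And>i. g $ i = 0 \<or> 0 < f $ i"
  shows "\<exists>\<epsilon>>0. \<forall>i. 0 \<le> (f + \<epsilon> *\<^sub>R g) $ i"
proof -
  define e where "e i = (if 0 < f $ i then f $ i / (\<bar>g $ i\<bar> + 1) else 1)" for i
  define \<epsilon> where "\<epsilon> = Min (range e)"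
  have e_pos: "0 < e i" for i
    by (auto simp: e_def intro!: divide_pos_pos)
  have "0 < \<epsilon>"
    unfolding \<epsilon>_def using e_pos by (subst Min_gr_iff) auto
  moreover have "0 \<le> f $ i + \<epsilon> * g $ i" for i
  proof (cases "g $ i = 0")
    case True
    then show ?thesis using f by simp
  next
    case False
    then have pos: "0 < f $ i" using g by blast
    have "\<epsilon> \<le> e i" by (simp add: \<epsilon>_def)
    then have "\<epsilon> * (\<bar>g $ i\<bar> + 1) \<le> f $ i"
      using pos by (simp add: e_def field_simps)
    moreover have "- (\<epsilon> * \<bar>g $ i\<bar>) \<le> \<epsilon> * g $ i"
      using \<open>0 < \<epsilon>\<close> by (simp add: abs_if)
    ultimately show ?thesis
      using \<open>0 < \<epsilon>\<close> by (simp add: distrib_left)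
  qed
  ultimately show ?thesis by auto
qed

text \<open>A nonzero \<open>d\<close> of this kind would give a second optimal primal point \<open>xs + \<epsilon> d\<close>: it is feasible
  for small \<open>\<epsilon>\<close>, and \<open>c \<bullet> d = ss \<bullet> d + ys \<bullet> (A *v d) = 0\<close>.\<close>

lemma unique_optimal_primal_kernel_trivial:
  assumes u: "unique_optimal_solution A b c (xs, ss, ys)"
    and d: "A *v d = 0" and supp: "\<And>i. d $ i = 0 \<or> (0 < xs $ i \<and> ss $ i = 0)"
  shows "d = 0"
proof -
  have P: "primal_optimal A b c xs" and D: "dual_optimal A b c ss ys"
    using u by (auto simp: unique_optimal_solution_def optimal_solution_def)
  have Axs: "A *v xs = b" and xs0: "\<And>i. 0 \<le> xs $ i"
    using P by (auto simp: primal_optimal_def primal_feasible_def)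
  have c: "c = ss + transpose A *v ys"
    using D by (auto simp: dual_optimal_def dual_feasible_def)
  obtain \<epsilon> where \<epsilon>: "\<epsilon> > 0" "\<And>i. 0 \<le> (xs + \<epsilon> *\<^sub>R d) $ i"
    using exists_step_preserving_nonneg[of xs d] xs0 supp by blast
  have "ss \<bullet> d = 0"
    unfolding inner_vec_def using supp by (intro sum.neutral) auto
  moreover have "(transpose A *v ys) \<bullet> d = 0"
    unfolding inner_transpose by (simp add: d)
  ultimately have cd: "c \<bullet> d = 0"
    unfolding c inner_add_left by simp
  have "A *v (xs + \<epsilon> *\<^sub>R d) = b"
    by (simp add: matrix_vector_right_distrib matrix_vector_mult_scaleR Axs d)
  then have "primal_optimal A b c (xs + \<epsilon> *\<^sub>R d)"
    using P \<epsilon>(2) by (simp add: primal_optimal_def primal_feasible_def inner_add_right cd)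
  then have "(xs + \<epsilon> *\<^sub>R d, ss, ys) = (xs, ss, ys)"
    using u D unfolding unique_optimal_solution_def optimal_solution_def by blast
  then show ?thesis using \<epsilon>(1) by simp
qed

text \<open>The dual counterpart, with the perturbation \<open>\<epsilon> \<eta>\<close> of \<open>ys\<close>. The case where
  \<open>transpose A *v \<eta> = 0\<close> shows that uniqueness forces \<open>A\<close> to have full row rank.\<close>

lemma unique_optimal_dual_kernel_trivial:
  assumes u: "unique_optimal_solution A b c (xs, ss, ys)"
    and supp: "\<And>i. (transpose A *v \<eta>) $ i = 0 \<or> (xs $ i = 0 \<and> 0 < ss $ i)"
  shows "\<eta> = 0"
proof -
  define g where "g = - (transpose A *v \<eta>)"
  have P: "primal_optimal A b c xs" and D: "dual_optimal A b c ss ys"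
    using u by (auto simp: unique_optimal_solution_def optimal_solution_def)
  have Axs: "A *v xs = b"
    using P by (auto simp: primal_optimal_def primal_feasible_def)
  have c: "ss + transpose A *v ys = c" and ss0: "\<And>i. 0 \<le> ss $ i"
    using D by (auto simp: dual_optimal_def dual_feasible_def)
  have supp_g: "g $ i = 0 \<or> (xs $ i = 0 \<and> 0 < ss $ i)" for i
    using supp[of i] by (simp add: g_def)
  obtain \<epsilon> where \<epsilon>: "\<epsilon> > 0" "\<And>i. 0 \<le> (ss + \<epsilon> *\<^sub>R g) $ i"
    using exists_step_preserving_nonneg[of ss g] ss0 supp_g by blast
  have "g \<bullet> xs = 0"
    unfolding inner_vec_def using supp_g by (intro sum.neutral ballI) (metis inner_real_def mult_eq_0_iff)
  then have "b \<bullet> \<eta> = 0"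
    using inner_transpose[of A \<eta> xs] by (simp add: g_def Axs inner_commute)
  moreover have "(ss + \<epsilon> *\<^sub>R g) + transpose A *v (ys + \<epsilon> *\<^sub>R \<eta>) = c"
    unfolding g_def matrix_vector_right_distrib matrix_vector_mult_scaleR c[symmetric] by simp
  ultimately have "dual_optimal A b c (ss + \<epsilon> *\<^sub>R g) (ys + \<epsilon> *\<^sub>R \<eta>)"
    using D \<epsilon>(2) unfolding dual_optimal_def dual_feasible_def
    by (simp add: inner_add_right)
  then have "(xs, ss + \<epsilon> *\<^sub>R g, ys + \<epsilon> *\<^sub>R \<eta>) = (xs, ss, ys)"
    using u P unfolding unique_optimal_solution_def optimal_solution_def by blast
  then show ?thesis using \<epsilon>(1) by simp
qed

section \<open>Strong duality\<close>

lemma convex_value_cone: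
  fixes A :: "real ^ 'n ^ 'm"
  shows "convex {(A *v x, r) | x r. (\<forall>i. 0 \<le> x $ i) \<and> c \<bullet> x < r}"
proof (rule convexI, clarsimp)
  fix x x' :: "real ^ 'n" and r r' p q :: real
  assume *: "\<forall>i. 0 \<le> x $ i" "\<forall>i. 0 \<le> x' $ i" "c \<bullet> x < r" "c \<bullet> x' < r'"
    "0 \<le> p" "0 \<le> q" "p + q = 1"
  have "p * (c \<bullet> x - r) + q * (c \<bullet> x' - r') < 0"
    using * by (intro convex_bound_lt) auto
  then show "\<exists>z. p *\<^sub>R (A *v x) + q *\<^sub>R (A *v x') = A *v z \<and> (\<forall>i. 0 \<le> z $ i) \<and>
      c \<bullet> z < p * r + q * r'"
    using * by (intro exI[of _ "p *\<^sub>R x + q *\<^sub>R x'"])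
      (auto simp: matrix_vector_right_distrib matrix_vector_mult_scaleR inner_add_right algebra_simps)
qed

text \<open>A separating hyperplane with normal \<open>(\<eta>, \<tau>)\<close> has \<open>\<tau> > 0\<close>, and \<open>y = - \<eta> / \<tau>\<close> is the required
  dual point.\<close>

lemma exists_dual_with_primal_value:
  fixes A :: "real ^ 'n ^ 'm"
  assumes P: "primal_optimal A b c xs"
    and rank: "\<And>\<eta>. transpose A *v \<eta> = 0 \<Longrightarrow> \<eta> = 0"
    and x0: "A *v x0 = b" "\<And>i. 0 < x0 $ i"
  shows "\<exists>s y. dual_feasible A c s y \<and> c \<bullet> xs \<le> b \<bullet> y"
proof -
  define \<gamma> where "\<gamma> = c \<bullet> xs"
  have xs: "A *v xs = b" "\<And>i. 0 \<le> xs $ i"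
    and opt: "\<And>x. A *v x = b \<Longrightarrow> (\<And>i. 0 \<le> x $ i) \<Longrightarrow> \<gamma> \<le> c \<bullet> x"
    using P by (auto simp: primal_optimal_def primal_feasible_def \<gamma>_def)
  let ?K = "{(A *v x, r) | x r. (\<forall>i. 0 \<le> x $ i) \<and> c \<bullet> x < r}"
  have "{(b, \<gamma>)} \<inter> ?K = {}"
    using opt by fastforce
  moreover have "(A *v 0, 1) \<in> ?K"
    by (rule CollectI, rule exI[of _ 0], rule exI[of _ 1]) simp
  then have "?K \<noteq> {}" by blast
  ultimately have "\<exists>a \<theta>. a \<noteq> 0 \<and> (\<forall>k\<in>{(b, \<gamma>)}. a \<bullet> k \<le> \<theta>) \<and> (\<forall>k\<in>?K. \<theta> \<le> a \<bullet> k)"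
    by (intro separating_hyperplane_sets convex_value_cone) auto
  then obtain a \<theta> where "a \<noteq> 0" and le: "a \<bullet> (b, \<gamma>) \<le> \<theta>"
    and ge: "\<And>k. k \<in> ?K \<Longrightarrow> \<theta> \<le> a \<bullet> k"
    by blast
  obtain \<eta> \<tau> where a: "a = (\<eta>, \<tau>)" by (cases a)
  have nz: "\<eta> \<noteq> 0 \<or> \<tau> \<noteq> 0"
    using \<open>a \<noteq> 0\<close> by (auto simp: a zero_prod_def)
  have strict: "\<eta> \<bullet> b + \<tau> * \<gamma> \<le> \<eta> \<bullet> (A *v x) + \<tau> * r"
    if "\<And>i. 0 \<le> x $ i" "c \<bullet> x < r" for x r
  proof -
    have "(A *v x, r) \<in> ?K" using that by blast
    then have "a \<bullet> (b, \<gamma>) \<le> a \<bullet> (A *v x, r)" using le ge by (meson order_trans)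
    then show ?thesis by (simp add: a)
  qed
  have sep: "\<eta> \<bullet> b + \<tau> * \<gamma> \<le> \<eta> \<bullet> (A *v x) + \<tau> * (c \<bullet> x)"
    if "\<And>i. 0 \<le> x $ i" for x
  proof (rule tendsto_lowerbound)
    show "((\<lambda>t. \<eta> \<bullet> (A *v x) + \<tau> * (c \<bullet> x + t)) \<longlongrightarrow> \<eta> \<bullet> (A *v x) + \<tau> * (c \<bullet> x)) (at_right 0)"
      by (auto intro!: tendsto_eq_intros)
    show "\<forall>\<^sub>F t in at_right 0. \<eta> \<bullet> b + \<tau> * \<gamma> \<le> \<eta> \<bullet> (A *v x) + \<tau> * (c \<bullet> x + t)"
      using eventually_at_right_less[of 0]
      by eventually_elim (intro strict that, auto)
  qed simp
  have "0 \<le> \<tau>"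
    using strict[OF xs(2), of "\<gamma> + 1"] by (simp add: \<gamma>_def xs(1) algebra_simps)
  moreover have "\<tau> \<noteq> 0"
  proof
    assume \<tau>: "\<tau> = 0"
    define g where "g = transpose A *v \<eta>"
    have g: "g \<bullet> x0 \<le> g \<bullet> x" if "\<And>i. 0 \<le> x $ i" for x
      using sep[OF that] by (simp only: g_def inner_transpose) (simp add: \<tau> x0(1))
    \<comment> \<open>A small step from the positive point \<open>x0\<close> along \<open>- g\<close> stays nonnegative and lowers
      the inner product with \<open>g\<close> unless \<open>g = 0\<close>.\<close>
    have "g = 0"
    proof -
      obtain \<epsilon> where "\<epsilon> > 0" "\<And>i. 0 \<le> (x0 + \<epsilon> *\<^sub>R (- g)) $ i"
        using exists_step_preserving_nonneg[of x0 "- g"] x0(2) less_imp_le by metis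
      from g[OF this(2)] this(1) have "g \<bullet> g \<le> 0"
        by (simp add: inner_add_right mult_le_0_iff inner_diff_right)
      then show ?thesis by (metis inner_eq_zero_iff inner_ge_zero order_antisym)
    qed
    then have "\<eta> = 0" using rank by (simp add: g_def)
    then show False using nz \<tau> by simp
  qed
  ultimately have \<tau>: "0 < \<tau>" by simp
  define y where "y = - (inverse \<tau> *\<^sub>R \<eta>)"
  define s where "s = c - transpose A *v y"
  have \<eta>: "\<eta> = - (\<tau> *\<^sub>R y)" using \<tau> by (simp add: y_def)
  have gap: "\<gamma> - b \<bullet> y \<le> s \<bullet> x" if "\<And>i. 0 \<le> x $ i" for x
  proof -
    have "\<tau> * (\<gamma> - b \<bullet> y) \<le> \<tau> * (c \<bullet> x - y \<bullet> (A *v x))"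
      using sep[OF that] by (simp add: \<eta> inner_commute algebra_simps)
    then have "\<gamma> - b \<bullet> y \<le> c \<bullet> x - y \<bullet> (A *v x)" using \<tau> by simp
    then show ?thesis by (simp only: s_def inner_diff_left inner_transpose)
  qed
  have vals: "\<gamma> \<le> b \<bullet> y" using gap[of 0] by simp
  have "0 \<le> s $ i" for i
  proof (rule ccontr)
    assume "\<not> 0 \<le> s $ i"
    then have neg: "s $ i < 0" by simp
    \<comment> \<open>Far out on the \<open>i\<close>-th axis the gap inequality fails.\<close>
    define k where "k = (b \<bullet> y - \<gamma> + 1) / - (s $ i)"
    have "0 \<le> k" unfolding k_def using neg vals by (intro divide_nonneg_pos) auto
    then have "\<gamma> - b \<bullet> y \<le> s \<bullet> axis i k"
      by (intro gap) (simp add: axis_def)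
    also have "\<dots> = \<gamma> - b \<bullet> y - 1"
      using neg by (simp add: inner_axis k_def)
    finally show False by simp
  qed
  then have "dual_feasible A c s y"
    unfolding dual_feasible_def s_def by simp
  then show ?thesis using vals \<gamma>_def by blast
qed

lemma complementary_slackness:
  fixes A :: "real ^ 'n ^ 'm"
  assumes u: "unique_optimal_solution A b c (xs, ss, ys)"
    and x0: "A *v x0 = b" "\<And>i. 0 < x0 $ i"
  shows "xs $ i * ss $ i = 0"
proof -
  have P: "primal_optimal A b c xs" and D: "dual_optimal A b c ss ys"
    using u by (auto simp: unique_optimal_solution_def optimal_solution_def)
  have xs: "A *v xs = b" "\<And>i. 0 \<le> xs $ i"
    using P by (auto simp: primal_optimal_def primal_feasible_def)
  have ss: "c = ss + transpose A *v ys" "\<And>i. 0 \<le> ss $ i"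
    using D by (auto simp: dual_optimal_def dual_feasible_def)
  have "\<eta> = 0" if "transpose A *v \<eta> = 0" for \<eta>
    using unique_optimal_dual_kernel_trivial[OF u] that by (metis zero_index)
  from exists_dual_with_primal_value[OF P this x0]
  have "c \<bullet> xs \<le> b \<bullet> ys"
    using D unfolding dual_optimal_def by fastforce
  moreover have "c \<bullet> xs = ss \<bullet> xs + b \<bullet> ys"
    unfolding ss(1) inner_add_left inner_transpose xs(1) by (simp add: inner_commute)
  ultimately have "ss \<bullet> xs \<le> 0" by simp
  moreover have "0 \<le> ss $ j * xs $ j" for j
    using xs(2) ss(2) by simp
  ultimately have "(\<Sum>j\<in>UNIV. ss $ j * xs $ j) = 0"
    unfolding inner_vec_def by (intro antisym sum_nonneg) auto
  then show ?thesis
    using \<open>\<And>j. 0 \<le> ss $ j * xs $ j\<close> by (subst (asm) sum_nonneg_eq_0_iff) auto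
qed

section \<open>The optimal basis\<close>

lemma bij_basis_index:
  fixes B :: "'n::finite set"
  assumes "card B = CARD('m::finite)"
  shows "bij_betw (basis_index B :: 'm \<Rightarrow> 'n) UNIV B"
proof -
  have "\<exists>e. bij_betw e (UNIV :: 'm set) B"
    using assms by (intro finite_same_card_bij) auto
  then show ?thesis unfolding basis_index_def by (rule someI_ex)
qed

lemma basis_matrix_mult_restriction:
  fixes A :: "real ^ 'n ^ 'm"
  assumes "card B = CARD('m)" and supp: "\<And>k. k \<notin> B \<Longrightarrow> d $ k = 0"
  shows "basis_matrix A B *v basis_part d B = A *v d"
proof -
  let ?e = "basis_index B :: 'm \<Rightarrow> 'n"
  have "(\<Sum>j\<in>UNIV. A $ r $ ?e j * d $ ?e j) = (\<Sum>k\<in>UNIV. A $ r $ k * d $ k)" for r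
  proof -
    have "(\<Sum>j\<in>UNIV. A $ r $ ?e j * d $ ?e j) = (\<Sum>k\<in>B. A $ r $ k * d $ k)"
      by (rule sum.reindex_bij_betw[OF bij_basis_index[OF assms(1)]])
    also have "\<dots> = (\<Sum>k\<in>UNIV. A $ r $ k * d $ k)"
      using supp by (intro sum.mono_neutral_left) auto
    finally show ?thesis .
  qed
  then show ?thesis
    by (simp add: basis_matrix_def basis_part_def matrix_vector_mult_def vec_eq_iff)
qed

lemma transpose_basis_matrix_mult:
  fixes A :: "real ^ 'n ^ 'm"
  shows "transpose (basis_matrix A B) *v y = basis_part (transpose A *v y) B"
  by (simp only: transpose_def basis_matrix_def basis_part_def matrix_vector_mult_def
      vec_eq_iff vec_lambda_beta) simp

text \<open>The map \<open>A\<close> sends the vectors supported in \<open>B\<close>, a space of dimension \<open>card B\<close>, injectively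
  into \<open>real ^ 'm\<close>; its image there is everything, since nothing nonzero is orthogonal to it.\<close>

lemma basis_card:
  fixes A :: "real ^ 'n ^ 'm"
  assumes inj: "\<And>d. A *v d = 0 \<Longrightarrow> (\<And>k. k \<notin> B \<Longrightarrow> d $ k = 0) \<Longrightarrow> d = 0"
    and surj: "\<And>\<eta>. (\<And>k. k \<in> B \<Longrightarrow> (transpose A *v \<eta>) $ k = 0) \<Longrightarrow> \<eta> = 0"
  shows "card B = CARD('m)"
proof -
  define L where "L = {d :: real ^ 'n. \<forall>k. k \<notin> B \<longrightarrow> d $ k = 0}"
  have sub: "subspace L"
    by (auto simp: L_def subspace_def)
  have lin: "linear ((*v) A)" by (rule matrix_vector_mul_linear)
  have "inj_on ((*v) A) L"
  proof (rule inj_onI)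
    fix d d' assume *: "d \<in> L" "d' \<in> L" "A *v d = A *v d'"
    then have "d - d' = 0"
      by (intro inj) (auto simp: L_def matrix_vector_mult_diff_distrib)
    then show "d = d'" by simp
  qed
  then have "dim ((*v) A ` L) = dim L"
    using sub by (intro dim_image_eq lin) (simp add: span_eq_iff[THEN iffD2])
  also have "dim L = card B"
  proof -
    let ?E = "(\<lambda>k. axis k 1 :: real ^ 'n) ` B"
    have L: "L = {d. \<forall>i\<in>Basis. i \<notin> ?E \<longrightarrow> d \<bullet> i = 0}"
      by (auto simp: L_def Basis_vec_def inner_axis axis_eq_axis)
    have "dim L = card ?E"
      unfolding L by (rule dim_substandard) (auto simp: Basis_vec_def)
    also have "\<dots> = card B"
      by (intro card_image inj_onI) (simp add: axis_eq_axis)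
    finally show ?thesis .
  qed
  finally have dim: "dim ((*v) A ` L) = card B" .
  have "span ((*v) A ` L) = UNIV"
  proof (rule ccontr)
    assume "span ((*v) A ` L) \<noteq> UNIV"
    then obtain \<eta> where \<eta>: "\<eta> \<noteq> 0" "\<And>z. z \<in> span ((*v) A ` L) \<Longrightarrow> \<eta> \<bullet> z = 0"
      using span_not_UNIV_orthogonal by blast
    have "(transpose A *v \<eta>) $ k = 0" if "k \<in> B" for k
    proof -
      have "axis k 1 \<in> L" using that by (auto simp: L_def axis_def)
      then have "(transpose A *v \<eta>) \<bullet> axis k 1 = 0"
        unfolding inner_transpose by (intro \<eta>(2) span_base) auto
      then show ?thesis unfolding inner_axis by simp
    qed
    then show False using surj \<eta>(1) by blast
  qed
  then have "dim ((*v) A ` L) = DIM(real ^ 'm)"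
    by (metis dim_UNIV dim_span)
  then show ?thesis using dim by simp
qed

lemma basis_matrix_invertible:
  fixes A :: "real ^ 'n ^ 'm"
  assumes inj: "\<And>d. A *v d = 0 \<Longrightarrow> (\<And>k. k \<notin> B \<Longrightarrow> d $ k = 0) \<Longrightarrow> d = 0"
    and card: "card B = CARD('m)"
  shows "invertible (basis_matrix A B)"
proof -
  let ?e = "basis_index B :: 'm \<Rightarrow> 'n"
  have e: "bij_betw ?e UNIV B" by (rule bij_basis_index[OF card])
  have "z = 0" if z: "basis_matrix A B *v z = 0" for z
  proof -
    define d where "d = (\<chi> k. if k \<in> B then z $ inv ?e k else 0)"
    have part: "basis_part d B = z"
      using e by (auto simp: basis_part_def d_def vec_eq_iff bij_betw_def inv_f_f)
    have "d = 0"
    proof (rule inj)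
      show "A *v d = 0"
        using basis_matrix_mult_restriction[OF card, of d A] part z by (simp add: d_def)
    qed (simp add: d_def)
    then show ?thesis using part by (simp add: basis_part_def vec_eq_iff)
  qed
  then show ?thesis
    by (simp add: invertible_left_inverse matrix_left_invertible_ker)
qed

lemma candidate_eqI:
  fixes A :: "real ^ 'n ^ 'm"
  assumes card: "card B = CARD('m)" and inv: "invertible (basis_matrix A B)"
    and x: "A *v x = b" "\<And>k. k \<notin> B \<Longrightarrow> x $ k = 0"
    and s: "s + transpose A *v y = c" "\<And>k. k \<in> B \<Longrightarrow> s $ k = 0"
  shows "candidate A b c B = (x, s, y)"
proof -
  let ?e = "basis_index B :: 'm \<Rightarrow> 'n" and ?M = "basis_matrix A B"
  have e: "bij_betw ?e UNIV B" by (rule bij_basis_index[OF card])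
  have M: "matrix_inv ?M ** ?M = mat 1" "?M ** matrix_inv ?M = mat 1"
    using inv unfolding invertible_def matrix_inv_def
    by (metis (mono_tags, lifting) someI_ex)+
  have "matrix_inv ?M *v b = basis_part x B"
    using basis_matrix_mult_restriction[OF card x(2), of A] M(1)
    by (metis x(1) matrix_vector_mul_assoc matrix_vector_mul_lid)
  moreover have "?e (inv ?e k) = k" if "k \<in> B" for k
    using e that by (auto simp: bij_betw_def intro: f_inv_into_f)
  ultimately have cx: "candidate_x A b B = x"
    using x(2) by (auto simp: candidate_x_def basis_part_def vec_eq_iff)
  have "basis_part (transpose A *v y) B = (basis_part c B :: real ^ 'm)"
  proof -
    have "?e j \<in> B" for j using e by (auto simp: bij_betw_def)
    then have "c $ ?e j = (transpose A *v y) $ ?e j" for j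
      using s(2) unfolding s(1)[symmetric] vector_add_component by simp
    then show ?thesis by (simp only: basis_part_def)
  qed
  then have "basis_part c B = transpose ?M *v y"
    using transpose_basis_matrix_mult[of A B y] by (simp only:)
  then have cy: "candidate_y A c B = y"
    unfolding candidate_y_def
    by (metis M(2) matrix_transpose_mul matrix_vector_mul_assoc matrix_vector_mul_lid transpose_mat)
  have col: "column k A \<bullet> y = (transpose A *v y) $ k" for k
    by (simp only: column_def inner_vec_def transpose_def matrix_vector_mult_def vec_lambda_beta) simp
  have "candidate_s A c B = s"
    unfolding candidate_s_def vec_eq_iff cy col using s by (auto simp del: transpose_matrix_vector)
  then show ?thesis by (simp add: candidate_def cx cy)
qed

lemma trial_basis_eq:
  fixes a :: "real ^ 'n"
  assumes p: "decreasing_ordering a p"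
    and sep: "\<And>i j. i \<in> B \<Longrightarrow> j \<notin> B \<Longrightarrow> a $ j < a $ i"
  shows "trial_basis (card B) p = B"
proof -
  have bij: "bij_betw p {1..CARD('n)} UNIV"
    and desc: "\<And>i. i \<in> {1..<CARD('n)} \<Longrightarrow> a $ p (i + 1) \<le> a $ p i"
    using p by (auto simp: decreasing_ordering_def)
  have mono: "a $ p l \<le> a $ p k" if "k \<le> l" "1 \<le> k" "l \<le> CARD('n)" for k l
    using that
  proof (induction l rule: dec_induct)
    case (step l)
    then show ?case using desc[of l] by force
  qed simp
  have le: "card B \<le> CARD('n)" by (intro card_mono) auto
  have card: "card (trial_basis (card B) p) = card B"
    unfolding trial_basis_def using bij le
    by (subst card_image) (auto simp: bij_betw_def elim: inj_on_subset)
  have "trial_basis (card B) p \<subseteq> B"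
  proof (rule ccontr)
    assume "\<not> trial_basis (card B) p \<subseteq> B"
    then obtain k where k: "k \<in> {1..card B}" "p k \<notin> B"
      unfolding trial_basis_def by blast
    then have "p k \<in> trial_basis (card B) p" by (auto simp: trial_basis_def)
    then have "\<not> B \<subseteq> trial_basis (card B) p"
      using card k(2) card_subset_eq[of "trial_basis (card B) p" B] by (auto simp: trial_basis_def)
    then obtain i where i: "i \<in> B" "i \<notin> trial_basis (card B) p" by blast
    obtain l where l: "l \<in> {1..CARD('n)}" "i = p l"
      using bij by (force simp: bij_betw_def)
    have "\<not> l \<le> card B" using i(2) l by (auto simp: trial_basis_def)
    then have "a $ p l \<le> a $ p k" using k l by (intro mono) auto
    then show False using sep[OF i(1) k(2)] l by simp
  qed
  then show ?thesis using card by (intro card_subset_eq) auto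
qed

section \<open>The centering condition\<close>

lemma target_interior_rho_pos:
  assumes "z \<in> target_interior A b c"
  shows "0 < rho (snd z)"
  using assms by (auto simp: target_interior_def target_domain_def control_set_def rho_def
      intro!: divide_pos_pos)

text \<open>Put \<open>q\<^sub>j = (r\<^sub>j - \<rho>) / r\<^sub>j\<close>. Then \<open>\<chi>\<^sub>2\<close> is the norm of \<open>q\<close>, and \<open>\<chi>\<^sub>1\<^sup>2\<close> is the sum of the
  \<open>q\<^sub>j\<^sup>2\<close> weighted by \<open>r\<^sub>j / \<rho>\<close>. If \<open>r\<^sub>l\<close> is the smallest residual and
  \<open>\<chi>\<^sub>2 \<noteq> 0\<close> (otherwise every residual equals \<open>\<rho>\<close>), then
  \<open>\<beta> \<ge> \<chi>\<^sub>1\<^sup>2 / \<chi>\<^sub>2 \<ge> (r\<^sub>l / \<rho>) \<chi>\<^sub>2 \<ge> (r\<^sub>l / \<rho>) \<bar>q\<^sub>l\<bar> = \<bar>r\<^sub>l - \<rho>\<bar> / \<rho>\<close>.\<close>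

lemma residual_ge_of_delta_le:
  fixes z :: "('m, 'n::finite) pd_point \<times> 'n control"
  assumes r_pos: "\<And>j. 0 < residual z $ j" and \<rho>: "0 < rho (snd z)"
    and \<beta>: "0 \<le> \<beta>" "delta z \<le> \<beta>"
  shows "(1 - \<beta>) * rho (snd z) \<le> residual z $ j"
proof -
  define \<rho> where "\<rho> = rho (snd z)"
  define r where "r j = residual z $ j" for j
  define q where "q j = (r j - \<rho>) / r j" for j
  have r: "0 < r j" for j using r_pos by (simp add: r_def)
  have \<rho>: "0 < \<rho>" using assms(2) by (simp add: \<rho>_def)
  have chi2: "chi 2 z = sqrt (\<Sum>j\<in>UNIV. (q j)\<^sup>2)"
    by (simp add: chi_def q_def r_def \<rho>_def power_divide)
  have chi1: "(chi 1 z)\<^sup>2 = (\<Sum>j\<in>UNIV. (q j)\<^sup>2 * (r j / \<rho>))"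
  proof -
    have "(chi 1 z)\<^sup>2 = (\<Sum>j\<in>UNIV. (r j - \<rho>)\<^sup>2 / (r j * \<rho>))"
      unfolding chi_def r_def[symmetric] \<rho>_def[symmetric] using r \<rho>
      by (subst real_sqrt_pow2) (auto intro!: sum_nonneg divide_nonneg_pos mult_pos_pos)
    also have "\<dots> = (\<Sum>j\<in>UNIV. (q j)\<^sup>2 * (r j / \<rho>))"
    proof (rule sum.cong)
      show "(r j - \<rho>)\<^sup>2 / (r j * \<rho>) = (q j)\<^sup>2 * (r j / \<rho>)" for j
        using r[of j] \<rho> by (simp add: q_def power2_eq_square field_simps)
    qed simp
    finally show ?thesis .
  qed
  \<comment> \<open>It suffices to treat the smallest residual.\<close>
  define l where "l = arg_min_on r UNIV"
  have l: "r l \<le> r j" for j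
    unfolding l_def by (rule arg_min_least) auto
  have q_le: "\<bar>q l\<bar> \<le> chi 2 z"
  proof -
    have "(q l)\<^sup>2 \<le> (\<Sum>j\<in>UNIV. (q j)\<^sup>2)" by (rule member_le_sum) auto
    then show ?thesis unfolding chi2 by (metis real_sqrt_abs real_sqrt_le_iff)
  qed
  have "r l / \<rho> * \<bar>q l\<bar> \<le> \<beta>"
  proof (cases "chi 2 z = 0")
    case True
    then show ?thesis using q_le \<beta> by simp
  next
    case False
    moreover have "0 \<le> chi 2 z" unfolding chi2 by (simp add: sum_nonneg)
    ultimately have pos: "0 < chi 2 z" by simp
    have "r l / \<rho> * (chi 2 z)\<^sup>2 = (\<Sum>j\<in>UNIV. (q j)\<^sup>2 * (r l / \<rho>))"
      unfolding chi2 by (simp add: sum_nonneg sum_distrib_left sum_divide_distrib mult.commute)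
    also have "\<dots> \<le> (chi 1 z)\<^sup>2"
      unfolding chi1 using l \<rho> by (intro sum_mono mult_left_mono divide_right_mono) auto
    also have "\<dots> \<le> \<beta> * chi 2 z"
      using \<beta> pos by (simp add: delta_def divide_le_eq)
    finally have "(r l / \<rho> * chi 2 z) * chi 2 z \<le> \<beta> * chi 2 z"
      by (simp only: power2_eq_square mult.assoc)
    then have "r l / \<rho> * chi 2 z \<le> \<beta>"
      using pos by (simp only: mult_le_cancel_right_pos)
    then show ?thesis
      using q_le r[of l] \<rho> by (smt (verit) mult_left_mono divide_pos_pos)
  qed
  then have "\<bar>r l - \<rho>\<bar> \<le> \<beta> * \<rho>"
    using r[of l] \<rho> by (simp add: q_def field_simps)
  then have "(1 - \<beta>) * \<rho> \<le> r l" by (simp add: algebra_simps)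
  then show ?thesis using l[of j] by (simp add: r_def \<rho>_def)
qed

section \<open>Separation of basic and nonbasic coordinates\<close>

lemma feasible_differences_orthogonal:
  fixes A :: "real ^ 'n ^ 'm"
  assumes "A *v x = b" "A *v x' = b" "s + transpose A *v y = c" "s' + transpose A *v y' = c"
  shows "(x - x') \<bullet> (s - s') = 0"
proof -
  have "s - s' = transpose A *v (y' - y)"
    unfolding matrix_vector_mult_diff_distrib using assms(3,4) by (simp add: algebra_simps)
  then have "(s - s') \<bullet> (x - x') = (y' - y) \<bullet> (A *v (x - x'))"
    by (simp only: inner_transpose)
  also have "\<dots> = 0"
    using assms(1,2) by (simp add: matrix_vector_mult_diff_distrib)
  finally show ?thesis by (simp add: inner_commute)
qed

text \<open>The minima may be infinite in general; here both are over nonempty index sets.\<close>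

lemma pos_min_product_le:
  fixes xs ss :: "real ^ 'n"
  assumes "0 < xs $ i" "0 < ss $ j"
  shows "pos_min xs * pos_min ss \<le> ereal (xs $ i * ss $ j)"
proof -
  have "pos_min xs \<le> ereal (xs $ i)" "pos_min ss \<le> ereal (ss $ j)"
    unfolding pos_min_def using assms by (auto intro: INF_lower)
  moreover have "0 \<le> pos_min ss"
    unfolding pos_min_def by (intro INF_greatest) auto
  ultimately have "pos_min xs * pos_min ss \<le> ereal (xs $ i) * ereal (ss $ j)"
    using assms by (intro ereal_mult_mono) auto
  then show ?thesis by simp
qed

text \<open>Orthogonality and complementarity turn into \<open>xs \<bullet> s + x \<bullet> ss = x \<bullet> s\<close>, which is less than
  \<open>v0\<close> because the residual with index \<open>None\<close> is positive. All summands are nonnegative.\<close>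

lemma target_point_coordinate_bounds:
  fixes A :: "real ^ 'n ^ 'm" and xs ss x s v :: "real ^ 'n"
  assumes z: "((x, s, y), (v0, v)) \<in> target_interior A b c"
    and xs: "A *v xs = b" "\<And>i. 0 \<le> xs $ i"
    and ss: "ss + transpose A *v ys = c" "\<And>i. 0 \<le> ss $ i"
    and comp: "\<And>i. xs $ i * ss $ i = 0"
  shows "xs $ i * s $ i < v0" and "x $ i * ss $ i < v0"
proof -
  have x: "A *v x = b" "\<And>i. 0 < x $ i" and s: "s + transpose A *v y = c" "\<And>i. 0 < s $ i"
    and r: "\<And>j. 0 < residual ((x, s, y), (v0, v)) $ j"
    using z by (auto simp: target_interior_def target_domain_def strictly_feasible_def)
  have "s \<bullet> x < v0" using r[of None] by (simp add: residual_def)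
  moreover have "xs \<bullet> ss = 0"
    unfolding inner_vec_def using comp by (intro sum.neutral) auto
  ultimately have "xs \<bullet> s + x \<bullet> ss < v0"
    using feasible_differences_orthogonal[OF x(1) xs(1) s(1) ss(1)]
    by (simp add: inner_diff_left inner_diff_right inner_commute)
  moreover have "xs $ i * s $ i \<le> xs \<bullet> s"
    unfolding inner_vec_def inner_real_def using xs(2) s(2)
    by (intro member_le_sum[where f = "\<lambda>i. xs $ i * s $ i"]) (auto intro: mult_nonneg_nonneg less_imp_le)
  moreover have "x $ i * ss $ i \<le> x \<bullet> ss"
    unfolding inner_vec_def inner_real_def using ss(2) x(2)
    by (intro member_le_sum[where f = "\<lambda>i. x $ i * ss $ i"]) (auto intro: mult_nonneg_nonneg less_imp_le)
  moreover have "0 \<le> xs \<bullet> s" "0 \<le> x \<bullet> ss"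
    unfolding inner_vec_def inner_real_def using xs(2) s(2) ss(2) x(2)
    by (auto intro!: sum_nonneg mult_nonneg_nonneg intro: less_imp_le)
  ultimately show "xs $ i * s $ i < v0" "x $ i * ss $ i < v0" by auto
qed

text \<open>Here \<open>\<kappa> = (1 - \<beta>) \<rho>\<close> bounds every product \<open>x\<^sub>k s\<^sub>k\<close> from below, and the assumption on
  \<open>mu_star\<close> gives \<open>v0\<^sup>2 < \<kappa> xs\<^sub>i ss\<^sub>j\<close>.\<close>

lemma optimal_partition_separates:
  fixes A :: "real ^ 'n ^ 'm" and xs ss x s v :: "real ^ 'n"
  assumes z: "((x, s, y), (v0, v)) \<in> target_interior A b c"
    and xs: "A *v xs = b" "\<And>i. 0 \<le> xs $ i"
    and ss: "ss + transpose A *v ys = c" "\<And>i. 0 \<le> ss $ i"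
    and comp: "\<And>i. xs $ i * ss $ i = 0"
    and \<beta>: "0 \<le> \<beta>" "\<beta> < 1" and delta: "delta ((x, s, y), (v0, v)) \<le> \<beta>"
    and mu: "ereal (mu_star (v0, v))
           < ereal (1 - \<beta>) * ((pos_min xs * pos_min ss) / ereal (real CARD('n) + 1))"
    and i: "0 < xs $ i" and j: "0 < ss $ j"
  shows "x $ j < x $ i" and "s $ i < s $ j"
proof -
  define \<kappa> where "\<kappa> = (1 - \<beta>) * rho (v0, v)"
  have x: "\<And>i. 0 < x $ i" and s: "\<And>i. 0 < s $ i"
    and r: "\<And>j. 0 < residual ((x, s, y), (v0, v)) $ j"
    and w: "(norm v)\<^sup>2 < v0"
    using z by (auto simp: target_interior_def target_domain_def strictly_feasible_def control_set_def)
  have v0: "0 < v0" using w by (meson le_less_trans zero_le_power2)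
  have \<rho>: "0 < rho (v0, v)" using target_interior_rho_pos[OF z] by simp
  have \<kappa>_le: "\<kappa> \<le> x $ k * s $ k" for k
    using residual_ge_of_delta_le[OF r _ \<beta>(1) delta, of "Some k"] \<rho>
    by (simp add: \<kappa>_def residual_def) (smt (verit) zero_le_power2)
  have "ereal (mu_star (v0, v)) < ereal ((1 - \<beta>) * (xs $ i * ss $ j / (real CARD('n) + 1)))"
  proof (rule less_le_trans[OF mu])
    have "(pos_min xs * pos_min ss) / ereal (real CARD('n) + 1)
        \<le> ereal (xs $ i * ss $ j) / ereal (real CARD('n) + 1)"
      using i j by (intro ereal_divide_right_mono pos_min_product_le) auto
    then have "ereal (1 - \<beta>) * ((pos_min xs * pos_min ss) / ereal (real CARD('n) + 1))
        \<le> ereal (1 - \<beta>) * (ereal (xs $ i * ss $ j) / ereal (real CARD('n) + 1))"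
      using \<beta> by (intro ereal_mult_left_mono) auto
    then show "ereal (1 - \<beta>) * ((pos_min xs * pos_min ss) / ereal (real CARD('n) + 1))
        \<le> ereal ((1 - \<beta>) * (xs $ i * ss $ j / (real CARD('n) + 1)))"
      by simp
  qed
  then have "mu_star (v0, v) * rho (v0, v)
      < (1 - \<beta>) * (xs $ i * ss $ j / (real CARD('n) + 1)) * rho (v0, v)"
    using \<rho> unfolding less_ereal.simps by (rule mult_strict_right_mono)
  \<comment> \<open>In this product the factor \<open>v0 - (norm v)\<^sup>2\<close> cancels.\<close>
  moreover have "mu_star (v0, v) * rho (v0, v) = v0 * v0 / (real CARD('n) + 1)"
    using w by (simp add: mu_star_def rho_def power2_eq_square)
  moreover have "(1 - \<beta>) * (xs $ i * ss $ j / (real CARD('n) + 1)) * rho (v0, v)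
      = \<kappa> * xs $ i * ss $ j / (real CARD('n) + 1)"
    by (simp add: \<kappa>_def)
  moreover have "0 < real CARD('n) + 1" by (simp add: add_pos_nonneg)
  ultimately have key: "v0 * v0 < \<kappa> * xs $ i * ss $ j"
    by (simp only: divide_less_cancel)
  note bnd = target_point_coordinate_bounds[OF z xs ss comp]
  have \<kappa>_pos: "0 < \<kappa>" using \<beta> \<rho> by (simp add: \<kappa>_def)
  show "x $ j < x $ i"
  proof -
    have "\<kappa> * xs $ i \<le> x $ i * (xs $ i * s $ i)"
      using mult_right_mono[OF \<kappa>_le[of i] less_imp_le[OF i]] by (simp add: mult_ac)
    also have "\<dots> \<le> x $ i * v0"
      using bnd(1)[of i] x[of i] by (intro mult_left_mono) auto
    finally have "\<kappa> * xs $ i * ss $ j \<le> x $ i * v0 * ss $ j"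
      using j by (intro mult_right_mono) auto
    with key have "v0 * v0 < v0 * (x $ i * ss $ j)" by (simp add: mult_ac)
    then have "v0 < x $ i * ss $ j" using v0 by simp
    with bnd(2)[of j] have "x $ j * ss $ j < x $ i * ss $ j" by simp
    then show ?thesis using j by simp
  qed
  show "s $ i < s $ j"
  proof -
    have "\<kappa> * ss $ j \<le> s $ j * (x $ j * ss $ j)"
      using mult_right_mono[OF \<kappa>_le[of j] less_imp_le[OF j]] by (simp add: mult_ac)
    also have "\<dots> \<le> s $ j * v0"
      using bnd(2)[of j] s[of j] by (intro mult_left_mono) auto
    finally have "\<kappa> * ss $ j * xs $ i \<le> s $ j * v0 * xs $ i"
      using i by (intro mult_right_mono) auto
    with key have "v0 * v0 < v0 * (s $ j * xs $ i)" by (simp add: mult_ac)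
    then have "v0 < s $ j * xs $ i" using v0 by simp
    with bnd(1)[of i] have "xs $ i * s $ i < xs $ i * s $ j" by (simp add: mult_ac)
    then show ?thesis using i by simp
  qed
qed

section \<open>Finite identification of the optimal solution\<close>

theorem theorem4:
  fixes A :: "real ^ 'n ^ 'm" and b :: "real ^ 'm" and c :: "real ^ 'n"
    and xs ss x s v :: "real ^ 'n" and ys y :: "real ^ 'm" and v0 \<beta> :: real
  assumes "strictly_feasible A b c \<noteq> {}"
    and "unique_optimal_solution A b c (xs, ss, ys)"
    and "\<forall>i. 0 < (xs + ss) $ i"
    and "((x, s, y), (v0, v)) \<in> target_interior A b c"
    and "0 \<le> \<beta>" and "\<beta> < 1 / 3"
    and "delta ((x, s, y), (v0, v)) \<le> \<beta>"
    and "ereal (mu_star (v0, v))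
           < ereal (1 - \<beta>) * ((pos_min xs * pos_min ss) / ereal (real CARD('n) + 1))"
  shows "\<forall>a \<in> {x, (\<chi> i. inverse (s $ i)), (\<chi> i. x $ i * inverse (s $ i))}.
           \<forall>p. decreasing_ordering a p \<longrightarrow>
             invertible (basis_matrix A (trial_basis CARD('m) p)) \<and>
             candidate A b c (trial_basis CARD('m) p) = (xs, ss, ys)"
proof (intro ballI allI impI)
  fix a p
  assume a: "a \<in> {x, (\<chi> i. inverse (s $ i)), (\<chi> i. x $ i * inverse (s $ i))}"
    and p: "decreasing_ordering a p"
  define B where "B = {i. 0 < xs $ i}"
  have xs: "A *v xs = b" "\<And>i. 0 \<le> xs $ i" and ss: "ss + transpose A *v ys = c" "\<And>i. 0 \<le> ss $ i"
    using assms(2) by (auto simp: unique_optimal_solution_def optimal_solution_def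
        primal_optimal_def dual_optimal_def primal_feasible_def dual_feasible_def)
  have x: "A *v x = b" "\<And>i. 0 < x $ i" and s: "\<And>i. 0 < s $ i"
    using assms(4) by (auto simp: target_interior_def target_domain_def strictly_feasible_def)
  have comp: "xs $ i * ss $ i = 0" for i
    by (rule complementary_slackness[OF assms(2) x])
  have B: "ss $ k = 0" "0 < xs $ k" if "k \<in> B" for k
    using comp[of k] that by (auto simp: B_def)
  have N: "xs $ k = 0" "0 < ss $ k" if "k \<notin> B" for k
  proof -
    show "xs $ k = 0" using that xs(2)[of k] by (auto simp: B_def)
    then show "0 < ss $ k" using assms(3)[rule_format, of k] by simp
  qed
  have inj: "d = 0" if "A *v d = 0" "\<And>k. k \<notin> B \<Longrightarrow> d $ k = 0" for d
    using that B by (intro unique_optimal_primal_kernel_trivial[OF assms(2)]) auto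
  have surj: "\<eta> = 0" if "\<And>k. k \<in> B \<Longrightarrow> (transpose A *v \<eta>) $ k = 0" for \<eta>
    using that N unique_optimal_dual_kernel_trivial[OF assms(2)] by metis
  have card: "card B = CARD('m)" using basis_card[of A B] inj surj by blast
  have inv: "invertible (basis_matrix A B)"
    using basis_matrix_invertible[OF _ card, of A] inj by blast
  have "a $ j < a $ i" if ij: "i \<in> B" "j \<notin> B" for i j
  proof -
    have "x $ j < x $ i" "s $ i < s $ j"
      using optimal_partition_separates[OF assms(4) xs ss comp assms(5) _ assms(7,8), of i j]
        assms(6) B[OF ij(1)] N[OF ij(2)] by auto
    moreover from this(2) have "inverse (s $ j) < inverse (s $ i)"
      using s[of i] by (rule less_imp_inverse_less)
    ultimately show ?thesis
      using a x(2)[of j] s[of i] s[of j] by (auto intro!: mult_strict_mono)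
  qed
  then have "trial_basis CARD('m) p = B"
    using trial_basis_eq[OF p, of B] card by simp
  then show "invertible (basis_matrix A (trial_basis CARD('m) p)) \<and>
      candidate A b c (trial_basis CARD('m) p) = (xs, ss, ys)"
    using inv candidate_eqI[OF card inv xs(1) N(1) ss(1) B(1)] by simp
qed

end
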